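(* Let $0<T_{\min}<T_{\max}$ and let $A,A_J\in\mathbb{R}^{n\times n}$ be constant matrices. Consider the impulsive system $$\dot x(t)=Ax(t),\qquad x(t_k)=A_Jx(t_k^-),\qquad t\ge 0,\ k\in\mathbb{N}.$$ This system is stable for all sequences of impulse instants $0=t_0<t_1<t_2<\dots$ satisfying $t_k-t_{k-1}\in[T_{\min},T_{\max}]$ for all $k\in\mathbb{N}$ (in the sense defined in the context) if there exist a continuously differentiable map $X:[0,T_{\max}]\to\mathbb{S}^n$, a scalar $\rho>0$ and matrices $G,G_J\in\mathbb{R}^{n\times n}$ satisfying $$X(\tau)\succ 0\quad\text{and}\quad\begin{pmatrix}\dot X(\tau)+A^TG^T+GA&X(\tau)+\rho A^TG^T-G\\ X(\tau)+\rho GA-G^T&-\rho(G+G^T)\end{pmatrix}\prec 0\qquad\text{for all }\tau\in[0,T_{\max}],$$ as well as $$\begin{pmatrix}-X(\tau)&A_J^TG_J^T\\ G_JA_J&X(0)-G_J-G_J^T\end{pmatrix}\prec 0\qquad\text{for all }\tau\in[T_{\min},T_{\max}].$$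
   Context: $\mathbb{S}^n$ is the set of symmetric real $n\times n$ matrices; $\succ 0$ and $\prec 0$ denote positive and negative definiteness of symmetric matrices; a dot denotes the derivative. $f(t^-)$ denotes the limit from the left. In the impulsive system, the differential equation governs $x$ between impulse instants, and at each $t_k$, $k\in\mathbb{N}$, the state is reset according to the jump equation; solutions are piecewise continuously differentiable. Stability: there exist constants $M,\gamma>0$ such that $\|x(t)\|\le Me^{-\gamma t}\|x(0)\|$ for all $t\ge 0$, all initial conditions $x(0)\in\mathbb{R}^n$ and all sequences $0=t_0<t_1<t_2<\dots$ with $t_k-t_{k-1}\in[T_{\min},T_{\max}]$ for all $k\in\mathbb{N}$. *)

theory Defs
  imports "HOL-Analysis.Analysis"
begin

definition symmetric_mat :: "real^'n^'n \<Rightarrow> bool" where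
  "symmetric_mat M \<longleftrightarrow> transpose M = M"

definition pos_def_mat :: "real^'n^'n \<Rightarrow> bool" where
  "pos_def_mat M \<longleftrightarrow> symmetric_mat M \<and> (\<forall>v. v \<noteq> 0 \<longrightarrow> v \<bullet> (M *v v) > 0)"

definition neg_def_mat :: "real^'n^'n \<Rightarrow> bool" where
  "neg_def_mat M \<longleftrightarrow> symmetric_mat M \<and> (\<forall>v. v \<noteq> 0 \<longrightarrow> v \<bullet> (M *v v) < 0)"

(* block_mat P Q R S has block rows (P Q) and (R S).  In the type real^'c^'r the outer
   index 'r is the row index. *)
definition block_mat ::
  "real^'a^'c \<Rightarrow> real^'b^'c \<Rightarrow> real^'a^'d \<Rightarrow> real^'b^'d \<Rightarrow> real^('a + 'b)^('c + 'd)" where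
  "block_mat P Q R S = (\<chi> i j.
     case i of
       Inl r \<Rightarrow> (case j of Inl c \<Rightarrow> P $ r $ c | Inr c \<Rightarrow> Q $ r $ c)
     | Inr r \<Rightarrow> (case j of Inl c \<Rightarrow> R $ r $ c | Inr c \<Rightarrow> S $ r $ c))"

(* For Tmin > 0 the dwell-time condition makes t strictly increasing. *)
definition impulse_instants :: "real \<Rightarrow> real \<Rightarrow> (nat \<Rightarrow> real) \<Rightarrow> bool" where
  "impulse_instants Tmin Tmax t \<longleftrightarrow>
     t 0 = 0 \<and> (\<forall>k. t (Suc k) - t k \<in> {Tmin..Tmax})"

(* A solution is right-continuous at each t k, its left limit exists at each t (Suc k), and
   there is no jump at t 0 = 0.  Continuity of the derivative on each open interval follows
   from the differential equation. *)
definition impulsive_solution ::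
  "real^'n^'n \<Rightarrow> real^'n^'n \<Rightarrow> (nat \<Rightarrow> real) \<Rightarrow> (real \<Rightarrow> real^'n) \<Rightarrow> bool" where
  "impulsive_solution A AJ t x \<longleftrightarrow>
     (\<forall>k. continuous_on {t k..<t (Suc k)} x \<and>
          (\<forall>s\<in>{t k<..<t (Suc k)}. (x has_vector_derivative A *v x s) (at s)) \<and>
          (\<exists>l. (x \<longlongrightarrow> l) (at_left (t (Suc k))) \<and> x (t (Suc k)) = AJ *v l))"

definition impulsive_stable ::
  "real \<Rightarrow> real \<Rightarrow> real^'n^'n \<Rightarrow> real^'n^'n \<Rightarrow> bool" where
  "impulsive_stable Tmin Tmax A AJ \<longleftrightarrow>
     (\<exists>M>0. \<exists>\<gamma>>0. \<forall>t x. impulse_instants Tmin Tmax t \<longrightarrow> impulsive_solution A AJ t x \<longrightarrow>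
        (\<forall>s\<ge>0. norm (x s) \<le> M * exp (- \<gamma> * s) * norm (x 0)))"

end

theory Submission
  imports Defs
begin

text \<open>
  The timer-dependent function V(\<tau>, v) = v \<bullet> X(\<tau>) v decays exponentially along the flow and does not
  increase at jumps.  The slack matrices are eliminated by evaluating the block inequalities at the
  vectors (v, A v) and (v, A_J v), where all terms containing G, G_J and \<rho> cancel; compactness of
  [0, Tmax] and of the unit sphere makes the resulting strict inequalities uniform.
\<close>

section \<open>Matrix products as bilinear maps and quadratic forms of block matrices\<close>

lemma bounded_bilinear_matrix_vector_mult:
  "bounded_bilinear ((*v) :: real^'n^'m \<Rightarrow> real^'n \<Rightarrow> real^'m)"
  unfolding bilinear_conv_bounded_bilinear [symmetric] bilinear_def
  by (auto intro!: linearI simp: matrix_vector_mult_add_rdistrib scaleR_matrix_vector_assoc)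

lemma bounded_bilinear_matrix_matrix_mult:
  "bounded_bilinear ((**) :: real^'n^'m \<Rightarrow> real^'p^'n \<Rightarrow> real^'p^'m)"
  unfolding bilinear_conv_bounded_bilinear [symmetric] bilinear_def
  by (auto intro!: linearI
      simp: matrix_matrix_mult_def vec_eq_iff distrib_left distrib_right sum.distrib
        sum_distrib_left algebra_simps)

lemmas continuous_on_matrix_mult [continuous_intros] =
  bounded_bilinear.continuous_on [OF bounded_bilinear_matrix_vector_mult]
  bounded_bilinear.continuous_on [OF bounded_bilinear_matrix_matrix_mult]

lemma sum_UNIV_Plus:
  fixes f :: "'a::finite + 'b::finite \<Rightarrow> 'c::comm_monoid_add"
  shows "sum f UNIV = (\<Sum>a\<in>UNIV. f (Inl a)) + (\<Sum>b\<in>UNIV. f (Inr b))"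
  by (subst UNIV_Plus_UNIV [symmetric], subst sum.Plus) auto

text \<open>Expands the quadratic form of the block matrix at the stacked vector with components
  \<open>u\<close> and \<open>v\<close>. Nonvanishing is demanded of \<open>u\<close> alone, since
  \<open>v\<close> will be \<open>A *v u\<close> or \<open>AJ *v u\<close>, which may be
  zero.\<close>

lemma neg_def_block_mat:
  fixes P :: "real^'a^'a" and S :: "real^'b^'b"
  assumes "neg_def_mat (block_mat P Q R S)" and "u \<noteq> 0"
  shows "u \<bullet> (P *v u) + u \<bullet> (Q *v v) + v \<bullet> (R *v u) + v \<bullet> (S *v v) < 0"
proof -
  define w :: "real^('a + 'b)"
    where "w = (\<chi> i. case i of Inl a \<Rightarrow> u $ a | Inr b \<Rightarrow> v $ b)"
  obtain a where "u $ a \<noteq> 0"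
    using \<open>u \<noteq> 0\<close> by (auto simp: vec_eq_iff)
  then have "w $ Inl a \<noteq> 0"
    by (simp add: w_def)
  then have "w \<noteq> 0"
    by auto
  then have "w \<bullet> (block_mat P Q R S *v w) < 0"
    using assms(1) by (auto simp: neg_def_mat_def)
  moreover have "w \<bullet> (block_mat P Q R S *v w) =
      u \<bullet> (P *v u) + u \<bullet> (Q *v v) + v \<bullet> (R *v u) + v \<bullet> (S *v v)"
    by (simp add: inner_vec_def matrix_vector_mult_def block_mat_def w_def sum_UNIV_Plus
        distrib_left sum.distrib)
  ultimately show ?thesis
    by simp
qed

lemma inner_transpose:
  fixes B :: "real^'n^'m"
  shows "u \<bullet> (transpose B *v w) = w \<bullet> (B *v u)" and "(transpose B *v w) \<bullet> u = w \<bullet> (B *v u)"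
  using dot_lmul_matrix [of w B u] by (simp_all add: inner_commute)

lemma uminus_matrix_vector_mult:
  fixes M :: "real^'n^'m"
  shows "- M *v w = - (M *v w)"
  by (simp add: matrix_vector_mult_def vec_eq_iff sum_negf)

lemmas inner_matrix_simps =
  matrix_vector_mult_add_rdistrib matrix_vector_mult_diff_rdistrib matrix_vector_mul_assoc [symmetric]
  scaleR_matrix_vector_assoc [symmetric] inner_add_right inner_diff_right inner_minus_right
  uminus_matrix_vector_mult   inner_transpose

section \<open>Elimination of the slack matrices\<close>

text \<open>Along a solution of the differential equation the stacked vector of state and velocity
  is (v, A v). There the diagonal block contributes 2 v \<bullet> G A v, which the off-diagonal
  blocks cancel, and their \<rho>-terms cancel against the lower right block. What survives is the
  derivative of v \<bullet> X v along the flow.\<close>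

lemma flow_inequality:
  fixes A G X X' :: "real^'n^'n"
  assumes "neg_def_mat (block_mat
      (X' + transpose A ** transpose G + G ** A)
      (X + \<rho> *\<^sub>R (transpose A ** transpose G) - G)
      (X + \<rho> *\<^sub>R (G ** A) - transpose G)
      (- (\<rho> *\<^sub>R (G + transpose G))))"
    and "symmetric_mat X" and "v \<noteq> 0"
  shows "v \<bullet> (X' *v v) + 2 * (v \<bullet> (X *v (A *v v))) < 0"
proof -
  \<comment> \<open>Symmetry of \<open>X\<close> merges the two off-diagonal occurrences of
    \<open>X\<close> into one term with factor 2.\<close>
  have "(A *v v) \<bullet> (X *v v) = v \<bullet> (X *v (A *v v))"
    using assms(2) inner_transpose(1) [of "A *v v" X v] by (simp only: symmetric_mat_def)
  then show ?thesis
    using neg_def_block_mat [OF assms(1) assms(3), of "A *v v"]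
    \<comment> \<open>The default rule \<open>transpose_matrix_vector\<close> would turn transposes
      into row-vector products before \<open>inner_transpose\<close> can move them to the other
      argument.\<close>
    by (simp add: inner_matrix_simps algebra_simps del: transpose_matrix_vector)
qed

text \<open>At (v, A_J v) the two off-diagonal blocks yield exactly the \<open>GJ\<close>-terms that
  the lower right block subtracts, so only the energies before and after the jump remain.\<close>

lemma jump_inequality:
  fixes AJ GJ X X0 :: "real^'n^'n"
  assumes "neg_def_mat (block_mat (- X) (transpose AJ ** transpose GJ) (GJ ** AJ)
      (X0 - GJ - transpose GJ))"
    and "v \<noteq> 0"
  shows "(AJ *v v) \<bullet> (X0 *v (AJ *v v)) < v \<bullet> (X *v v)"
  using neg_def_block_mat [OF assms, of "AJ *v v"]
  by (simp add: inner_matrix_simps algebra_simps del: transpose_matrix_vector)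

section \<open>Uniform bounds on quadratic forms by compactness\<close>

text \<open>The form is jointly continuous on the compact product of \<open>S\<close> with the unit
  sphere, so it has a minimiser there. Homogeneity of degree two carries the bound to all vectors.
  Returning the minimiser, not just the minimum, lets positivity be read off afterwards.\<close>

lemma quadratic_form_attains_inf:
  fixes Q :: "real \<Rightarrow> real^'n^'n"
  assumes "compact S" and "S \<noteq> {}" and "continuous_on S Q"
  obtains \<tau>0 u where "\<tau>0 \<in> S" "norm u = 1"
    "\<And>\<tau> v. \<tau> \<in> S \<Longrightarrow> (u \<bullet> (Q \<tau>0 *v u)) * (norm v)\<^sup>2 \<le> v \<bullet> (Q \<tau> *v v)"
proof -
  let ?K = "S \<times> sphere (0::real^'n) 1"
  have "continuous_on ?K (\<lambda>p. snd p \<bullet> (Q (fst p) *v snd p))"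
    by (intro continuous_intros continuous_on_compose2 [OF assms(3)]) auto
  moreover have "compact ?K" "?K \<noteq> {}"
    using assms by (auto intro: compact_Times)
  ultimately obtain p where p: "p \<in> ?K"
    and min: "\<And>q. q \<in> ?K \<Longrightarrow> snd p \<bullet> (Q (fst p) *v snd p) \<le> snd q \<bullet> (Q (fst q) *v snd q)"
    using continuous_attains_inf [of ?K "\<lambda>p. snd p \<bullet> (Q (fst p) *v snd p)"] by blast
  show thesis
  proof (rule that [of "fst p" "snd p"])
    show "fst p \<in> S" "norm (snd p) = 1"
      using p by auto
    fix \<tau> and v :: "real^'n"
    assume \<tau>: "\<tau> \<in> S"
    show "(snd p \<bullet> (Q (fst p) *v snd p)) * (norm v)\<^sup>2 \<le> v \<bullet> (Q \<tau> *v v)"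
    proof (cases "v = 0")
      case False
      let ?v = "v /\<^sub>R norm v"
      have "snd p \<bullet> (Q (fst p) *v snd p) \<le> ?v \<bullet> (Q \<tau> *v ?v)"
        using min [of "(\<tau>, ?v)"] \<tau> False by simp
      also have "\<dots> = (v \<bullet> (Q \<tau> *v v)) / (norm v)\<^sup>2"
        by (simp add: matrix_vector_mult_scaleR power2_eq_square divide_inverse)
      finally show ?thesis
        using False by (simp add: pos_le_divide_eq)
    qed simp
  qed
qed

lemma pos_quadratic_form_bounded_below:
  fixes Q :: "real \<Rightarrow> real^'n^'n"
  assumes "compact S" and "S \<noteq> {}" and "continuous_on S Q"
    and pos: "\<And>\<tau> v. \<tau> \<in> S \<Longrightarrow> v \<noteq> 0 \<Longrightarrow> 0 < v \<bullet> (Q \<tau> *v v)"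
  obtains c where "c > 0" "\<And>\<tau> v. \<tau> \<in> S \<Longrightarrow> c * (norm v)\<^sup>2 \<le> v \<bullet> (Q \<tau> *v v)"
proof -
  obtain \<tau>0 u where "\<tau>0 \<in> S" "norm u = 1"
    and "\<And>\<tau> v. \<tau> \<in> S \<Longrightarrow> (u \<bullet> (Q \<tau>0 *v u)) * (norm v)\<^sup>2 \<le> v \<bullet> (Q \<tau> *v v)"
    using quadratic_form_attains_inf [OF assms(1-3)] by metis
  moreover from this have "u \<noteq> 0"
    by auto
  ultimately show thesis
    using that pos by blast
qed

lemma quadratic_form_bounded_above:
  fixes Q :: "real \<Rightarrow> real^'n^'n"
  assumes "compact S" and "continuous_on S Q"
  obtains C where "C > 0" "\<And>\<tau> v. \<tau> \<in> S \<Longrightarrow> v \<bullet> (Q \<tau> *v v) \<le> C * (norm v)\<^sup>2"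
proof -
  have "bounded (Q ` S)"
    using assms compact_continuous_image compact_imp_bounded by blast
  then obtain B where B: "\<And>\<tau>. \<tau> \<in> S \<Longrightarrow> norm (Q \<tau>) \<le> B"
    by (auto simp: bounded_iff)
  obtain K where "K > 0" and K: "\<And>M v. norm ((M :: real^'n^'n) *v v) \<le> norm M * norm v * K"
    using bounded_bilinear.pos_bounded [OF bounded_bilinear_matrix_vector_mult] by blast
  show thesis
  \<comment> \<open>The absolute value and the added 1 make the constant strictly positive, as
    \<open>B\<close> may be zero, or negative for empty \<open>S\<close>.\<close>
  proof (rule that [of "(\<bar>B\<bar> + 1) * K"])
    show "(\<bar>B\<bar> + 1) * K > 0"
      using \<open>K > 0\<close> by simp
    fix \<tau> v
    assume "\<tau> \<in> S"
    then have "norm (Q \<tau>) \<le> \<bar>B\<bar> + 1"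
      using B by force
    then have "norm (Q \<tau> *v v) \<le> (\<bar>B\<bar> + 1) * norm v * K"
      using K [of "Q \<tau>" v] \<open>K > 0\<close>
      by (meson mult_right_mono norm_ge_zero less_imp_le order_trans)
    then have "norm v * norm (Q \<tau> *v v) \<le> norm v * ((\<bar>B\<bar> + 1) * norm v * K)"
      by (intro mult_left_mono) auto
    then show "v \<bullet> (Q \<tau> *v v) \<le> (\<bar>B\<bar> + 1) * K * (norm v)\<^sup>2"
      using norm_cauchy_schwarz [of v "Q \<tau> *v v"] by (simp add: power2_eq_square mult_ac)
  qed
qed

section \<open>Decay between impulses and across jumps\<close>

text \<open>With the weight exp (\<gamma> s), the energy has derivative exp (\<gamma> s) (\<gamma> V
  + V'), which \<open>decay\<close> makes nonpositive. The timer is s - a, restarted at the left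
  end. The differential equation is asked for only in the open interval, with continuity up to the
  ends, to suit a solution extended by its left limit.\<close>

lemma flow_decay:
  fixes X X' :: "real \<Rightarrow> real^'n^'n" and y :: "real \<Rightarrow> real^'n"
  assumes "a \<le> b" and "b - a \<le> T"
    and y: "continuous_on {a..b} y"
      "\<And>s. s \<in> {a<..<b} \<Longrightarrow> (y has_vector_derivative A *v y s) (at s)"
    and X: "\<And>\<tau>. \<tau> \<in> {0..T} \<Longrightarrow> (X has_vector_derivative X' \<tau>) (at \<tau> within {0..T})"
    and sym: "\<And>\<tau>. \<tau> \<in> {0..T} \<Longrightarrow> symmetric_mat (X \<tau>)"
    and decay: "\<And>\<tau> v. \<tau> \<in> {0..T} \<Longrightarrow>
      v \<bullet> (X' \<tau> *v v) + 2 * (v \<bullet> (X \<tau> *v (A *v v))) \<le> - \<gamma> * (v \<bullet> (X \<tau> *v v))"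
  shows "exp (\<gamma> * b) * (y b \<bullet> (X (b - a) *v y b)) \<le> exp (\<gamma> * a) * (y a \<bullet> (X 0 *v y a))"
proof -
  let ?W = "\<lambda>s. exp (\<gamma> * s) * (y s \<bullet> (X (s - a) *v y s))"
  have "continuous_on {0..T} X"
    using X by (meson continuous_on_eq_continuous_within has_vector_derivative_continuous)
  then have "continuous_on {a..b} (\<lambda>s. X (s - a))"
    by (rule continuous_on_compose2) (use assms(2) in \<open>auto intro!: continuous_intros\<close>)
  then have "continuous_on {a..b} ?W"
    by (intro continuous_intros y)
  moreover have "\<exists>d. DERIV ?W s :> d \<and> d \<le> 0" if s: "a < s" "s < b" for s
  proof -
    let ?\<tau> = "s - a"
    \<comment> \<open>The strict bounds put the timer in the interior, where the one-sided
      derivative of \<open>X\<close> is an ordinary one and the chain rule applies.\<close>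
    have \<tau>: "?\<tau> \<in> {0..T}" "0 < ?\<tau>" "?\<tau> < T"
      using s assms(2) by auto
    have "(X has_vector_derivative X' ?\<tau>) (at ?\<tau>)"
      using X [OF \<tau>(1)] at_within_Icc_at [OF \<tau>(2,3)] by simp
    moreover have "((\<lambda>s. s - a) has_vector_derivative 1) (at s)"
      by (auto intro!: derivative_eq_intros)
    ultimately have dX: "((\<lambda>s. X (s - a)) has_vector_derivative X' ?\<tau>) (at s)"
      using vector_diff_chain_at [of "\<lambda>s. s - a" 1 s X "X' ?\<tau>"] by (simp add: o_def)
    have dy: "(y has_vector_derivative A *v y s) (at s)"
      using y(2) s by simp
    have "((\<lambda>s. y s \<bullet> (X (s - a) *v y s)) has_vector_derivative
        y s \<bullet> (X ?\<tau> *v (A *v y s) + X' ?\<tau> *v y s) + (A *v y s) \<bullet> (X ?\<tau> *v y s)) (at s)"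
      by (intro bounded_bilinear.has_vector_derivative [OF bounded_bilinear_inner]
          bounded_bilinear.has_vector_derivative [OF bounded_bilinear_matrix_vector_mult] dX dy)
    then have dV: "DERIV (\<lambda>s. y s \<bullet> (X (s - a) *v y s)) s :>
        y s \<bullet> (X ?\<tau> *v (A *v y s) + X' ?\<tau> *v y s) + (A *v y s) \<bullet> (X ?\<tau> *v y s)"
      by (simp add: has_real_derivative_iff_has_vector_derivative)
    have "(A *v y s) \<bullet> (X ?\<tau> *v y s) = y s \<bullet> (X ?\<tau> *v (A *v y s))"
      using sym [OF \<tau>(1)] inner_transpose(1) [of "A *v y s" "X ?\<tau>" "y s"]
      by (simp only: symmetric_mat_def)
    then have "DERIV ?W s :> exp (\<gamma> * s) * (\<gamma> * (y s \<bullet> (X ?\<tau> *v y s)) +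
        (y s \<bullet> (X' ?\<tau> *v y s) + 2 * (y s \<bullet> (X ?\<tau> *v (A *v y s)))))"
      by (auto intro!: derivative_eq_intros dV simp: algebra_simps)
    moreover have "exp (\<gamma> * s) * (\<gamma> * (y s \<bullet> (X ?\<tau> *v y s)) +
        (y s \<bullet> (X' ?\<tau> *v y s) + 2 * (y s \<bullet> (X ?\<tau> *v (A *v y s))))) \<le> 0"
      using decay [OF \<tau>(1), of "y s"] by (intro mult_nonneg_nonpos) auto
    ultimately show ?thesis
      by blast
  qed
  ultimately have "?W b \<le> ?W a"
    using DERIV_nonpos_imp_decreasing_open [OF assms(1), of ?W] by blast
  then show ?thesis
    by simp
qed

text \<open>The minimal dwell time forces t n \<ge> n Tmin, so impulses cannot accumulate. The first
  instant beyond \<open>s\<close> has positive index because t 0 = 0 \<le> s, and its predecessor is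
  the wanted \<open>k\<close>.\<close>

lemma impulse_instants_interval:
  assumes "impulse_instants Tmin Tmax t" and "0 < Tmin" and "0 \<le> s"
  obtains k where "t k \<le> s" "s < t (Suc k)"
proof -
  have grow: "real n * Tmin \<le> t n" for n
  proof (induction n)
    case (Suc n)
    moreover have "Tmin \<le> t (Suc n) - t n"
      using assms(1) by (simp add: impulse_instants_def)
    ultimately show ?case
      by (simp add: algebra_simps)
  qed (use assms(1) in \<open>simp add: impulse_instants_def\<close>)
  obtain n where "s < real n * Tmin"
    using reals_Archimedean3 [OF assms(2)] by blast
  then have ex: "\<exists>n. s < t n"
    using grow [of n] by (intro exI [of _ n]) simp
  define m where "m = (LEAST n. s < t n)"
  have "s < t m"
    unfolding m_def using ex by (rule LeastI_ex)
  moreover from this have "m \<noteq> 0"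
    using assms by (metis impulse_instants_def not_le)
  then obtain k where "m = Suc k"
    using not0_implies_Suc by blast
  moreover from this have "\<not> s < t k"
    using not_less_Least [of k "\<lambda>n. s < t n"] m_def by simp
  ultimately show thesis
    using that by (simp add: not_less)
qed

text \<open>Chains flow decay and jump comparison by induction over the impulse instants, then adds
  the last, incomplete interval. The right-hand side carries no exponential because the chain starts
  at time 0.\<close>

lemma impulsive_solution_decay:
  fixes X X' :: "real \<Rightarrow> real^'n^'n"
  assumes "0 < Tmin" and t: "impulse_instants Tmin Tmax t" and x: "impulsive_solution A AJ t x"
    and X: "\<And>\<tau>. \<tau> \<in> {0..Tmax} \<Longrightarrow> (X has_vector_derivative X' \<tau>) (at \<tau> within {0..Tmax})"
    and sym: "\<And>\<tau>. \<tau> \<in> {0..Tmax} \<Longrightarrow> symmetric_mat (X \<tau>)"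
    and decay: "\<And>\<tau> v. \<tau> \<in> {0..Tmax} \<Longrightarrow>
      v \<bullet> (X' \<tau> *v v) + 2 * (v \<bullet> (X \<tau> *v (A *v v))) \<le> - \<gamma> * (v \<bullet> (X \<tau> *v v))"
    and jump: "\<And>\<tau> v. \<tau> \<in> {Tmin..Tmax} \<Longrightarrow>
      (AJ *v v) \<bullet> (X 0 *v (AJ *v v)) \<le> v \<bullet> (X \<tau> *v v)"
    and s: "t k \<le> s" "s < t (Suc k)"
  shows "exp (\<gamma> * s) * (x s \<bullet> (X (s - t k) *v x s)) \<le> x 0 \<bullet> (X 0 *v x 0)"
proof -
  have step: "Tmin \<le> t (Suc k) - t k" "t (Suc k) - t k \<le> Tmax" for k
    using t by (auto simp: impulse_instants_def)
  have cont: "continuous_on {t k..<t (Suc k)} x"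
    and deriv: "\<And>s. s \<in> {t k<..<t (Suc k)} \<Longrightarrow> (x has_vector_derivative A *v x s) (at s)" for k
    using x by (auto simp: impulsive_solution_def)
  have instants: "exp (\<gamma> * t k) * (x (t k) \<bullet> (X 0 *v x (t k))) \<le> x 0 \<bullet> (X 0 *v x 0)" for k
  proof (induction k)
    case 0
    then show ?case
      using t by (simp add: impulse_instants_def)
  next
    case (Suc k)
    let ?a = "t k" and ?b = "t (Suc k)"
    obtain l where l: "(x \<longlongrightarrow> l) (at_left ?b)" and xb: "x ?b = AJ *v l"
      using x unfolding impulsive_solution_def by blast
    have ab: "?a < ?b"
      using step(1) [of k] \<open>0 < Tmin\<close> by simp
    \<comment> \<open>Replacing the value after the jump by the left limit makes the trajectory
      continuous on the closed interval, as \<open>flow_decay\<close> requires.\<close>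
    define y where "y = x(?b := l)"
    have y: "y s = x s" if "s \<noteq> ?b" for s
      using that by (simp add: y_def)
    have "continuous_on {?a..?b} y"
    proof -
      have "(y \<longlongrightarrow> y s) (at s within {?a..?b})" if s: "s \<in> {?a..?b}" for s
      proof (cases "s = ?b")
        case True
        have "(y \<longlongrightarrow> l) (at_left ?b)"
          by (rule Lim_transform_eventually [OF l])
            (auto simp: eventually_at_filter y)
        then show ?thesis
          using True at_within_Icc_at_left [OF ab] by (simp add: y_def)
      next
        case False
        then have "(x \<longlongrightarrow> x s) (at s within {?a..<?b})"
          using s cont [of k] by (simp add: continuous_on_def)
        \<comment> \<open>For s < ?b the right endpoint is invisible near \<open>s\<close>.\<close>
        moreover have "at s within {?a..<?b} = at s within {?a..?b}"
          by (rule at_within_nhd [of s "{..<?b}"]) (use s False in auto)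
        ultimately have "(x \<longlongrightarrow> x s) (at s within {?a..?b})"
          by simp
        moreover have "\<forall>\<^sub>F r in at s within {?a..?b}. x r = y r"
        proof -
          have "\<forall>\<^sub>F r in nhds s. r \<noteq> ?b"
            using False by (simp add: t1_space_nhds)
          then show ?thesis
            unfolding eventually_at_filter by eventually_elim (simp add: y)
        qed
        ultimately show ?thesis
          using y [OF False] by (auto intro: Lim_transform_eventually)
      qed
      then show ?thesis
        by (simp add: continuous_on_def)
    qed
    moreover have "(y has_vector_derivative A *v y s) (at s)" if s: "s \<in> {?a<..<?b}" for s
      using has_vector_derivative_transform_within_open [OF deriv [OF s], of "{?a<..<?b}" y] s
      by (auto simp: y)
    ultimately have
      "exp (\<gamma> * ?b) * (y ?b \<bullet> (X (?b - ?a) *v y ?b)) \<le> exp (\<gamma> * ?a) * (y ?a \<bullet> (X 0 *v y ?a))"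
      using ab step(2) [of k] by (intro flow_decay [where T = Tmax and A = A and X' = X'] X sym decay) auto
    then have
      "exp (\<gamma> * ?b) * (l \<bullet> (X (?b - ?a) *v l)) \<le> exp (\<gamma> * ?a) * (x ?a \<bullet> (X 0 *v x ?a))"
      using ab by (simp add: y_def)
    \<comment> \<open>The jump inequality is taken at the elapsed dwell time ?b - ?a, which lies in
      [Tmin, Tmax]; the timer then restarts at 0.\<close>
    moreover have "exp (\<gamma> * ?b) * (x ?b \<bullet> (X 0 *v x ?b)) \<le> exp (\<gamma> * ?b) * (l \<bullet> (X (?b - ?a) *v l))"
      unfolding xb using step [of k] by (intro mult_left_mono jump) auto
    ultimately show ?case
      using Suc.IH by (rule_tac order_trans [OF _ order_trans])
  qed
  \<comment> \<open>The interval [t k, s] stops before the next impulse, so \<open>x\<close> itself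
    is continuous there.\<close>
  have "exp (\<gamma> * s) * (x s \<bullet> (X (s - t k) *v x s)) \<le> exp (\<gamma> * t k) * (x (t k) \<bullet> (X 0 *v x (t k)))"
    using s step(2) [of k]
    by (intro flow_decay [where T = Tmax and A = A and X' = X'] X sym decay continuous_on_subset [OF cont [of k]])
      (auto intro: deriv [of _ k])
  then show ?thesis
    using instants [of k] by simp
qed

section \<open>Exponential stability with explicit constants\<close>

theorem lemma2:
  fixes Tmin Tmax :: real and A AJ :: "real^'n^'n"
  assumes "0 < Tmin" and "Tmin < Tmax"
    and "\<exists>(X :: real \<Rightarrow> real^'n^'n) (X' :: real \<Rightarrow> real^'n^'n) (\<rho> :: real)
           (G :: real^'n^'n) (GJ :: real^'n^'n).
      (\<forall>\<tau>\<in>{0..Tmax}. symmetric_mat (X \<tau>)) \<and>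
      (\<forall>\<tau>\<in>{0..Tmax}. (X has_vector_derivative X' \<tau>) (at \<tau> within {0..Tmax})) \<and>
      continuous_on {0..Tmax} X' \<and>
      \<rho> > 0 \<and>
      (\<forall>\<tau>\<in>{0..Tmax}.
         pos_def_mat (X \<tau>) \<and>
         neg_def_mat (block_mat
           (X' \<tau> + transpose A ** transpose G + G ** A)
           (X \<tau> + \<rho> *\<^sub>R (transpose A ** transpose G) - G)
           (X \<tau> + \<rho> *\<^sub>R (G ** A) - transpose G)
           (- (\<rho> *\<^sub>R (G + transpose G))))) \<and>
      (\<forall>\<tau>\<in>{Tmin..Tmax}.
         neg_def_mat (block_mat
           (- X \<tau>) (transpose AJ ** transpose GJ)
           (GJ ** AJ) (X 0 - GJ - transpose GJ)))"
  shows "impulsive_stable Tmin Tmax A AJ"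
proof -
  obtain X X' :: "real \<Rightarrow> real^'n^'n" and \<rho> and G GJ :: "real^'n^'n"
    where sym: "\<And>\<tau>. \<tau> \<in> {0..Tmax} \<Longrightarrow> symmetric_mat (X \<tau>)"
      and X: "\<And>\<tau>. \<tau> \<in> {0..Tmax} \<Longrightarrow> (X has_vector_derivative X' \<tau>) (at \<tau> within {0..Tmax})"
      and X': "continuous_on {0..Tmax} X'"
      and pos: "\<And>\<tau>. \<tau> \<in> {0..Tmax} \<Longrightarrow> pos_def_mat (X \<tau>)"
      and flow: "\<And>\<tau>. \<tau> \<in> {0..Tmax} \<Longrightarrow> neg_def_mat (block_mat
           (X' \<tau> + transpose A ** transpose G + G ** A)
           (X \<tau> + \<rho> *\<^sub>R (transpose A ** transpose G) - G)
           (X \<tau> + \<rho> *\<^sub>R (G ** A) - transpose G)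
           (- (\<rho> *\<^sub>R (G + transpose G))))"
      and jump: "\<And>\<tau>. \<tau> \<in> {Tmin..Tmax} \<Longrightarrow> neg_def_mat (block_mat
           (- X \<tau>) (transpose AJ ** transpose GJ)
           (GJ ** AJ) (X 0 - GJ - transpose GJ))"
    using assms(3) by metis
  have S: "compact {0..Tmax}" "{0..Tmax} \<noteq> {}"
    using assms by auto
  have contX: "continuous_on {0..Tmax} X"
    using X by (meson continuous_on_eq_continuous_within has_vector_derivative_continuous)
  obtain c where "c > 0" and c: "\<And>\<tau> v. \<tau> \<in> {0..Tmax} \<Longrightarrow> c * (norm v)\<^sup>2 \<le> v \<bullet> (X \<tau> *v v)"
    using pos_quadratic_form_bounded_below [OF S contX] pos unfolding pos_def_mat_def by metis
  obtain C where "C > 0" and C: "\<And>\<tau> v. \<tau> \<in> {0..Tmax} \<Longrightarrow> v \<bullet> (X \<tau> *v v) \<le> C * (norm v)\<^sup>2"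
    using quadratic_form_bounded_above [OF S(1) contX] by metis
  \<comment> \<open>Only the quadratic form of \<open>Q\<close> matters: it is minus the derivative
    of the energy along the flow. Its continuity, which compactness needs, rests on that of
    \<open>X'\<close>.\<close>
  define Q where "Q \<tau> = - X' \<tau> - 2 *\<^sub>R (X \<tau> ** A)" for \<tau>
  have Q: "v \<bullet> (Q \<tau> *v v) = - (v \<bullet> (X' \<tau> *v v) + 2 * (v \<bullet> (X \<tau> *v (A *v v))))" for \<tau> v
    by (simp add: Q_def inner_matrix_simps)
  have "continuous_on {0..Tmax} Q"
    unfolding Q_def by (intro continuous_intros X' contX)
  moreover have "0 < v \<bullet> (Q \<tau> *v v)" if "\<tau> \<in> {0..Tmax}" "v \<noteq> 0" for \<tau> v
    using flow_inequality [OF flow [OF that(1)] sym [OF that(1)] that(2)] by (simp add: Q)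
  ultimately obtain d where "d > 0" and d: "\<And>\<tau> v. \<tau> \<in> {0..Tmax} \<Longrightarrow> d * (norm v)\<^sup>2 \<le> v \<bullet> (Q \<tau> *v v)"
    using pos_quadratic_form_bounded_below [OF S] by metis
  \<comment> \<open>The energy V falls at rate at least d |v|^2, and |v|^2 \<ge> V / C, whence V'
    \<le> - (d / C) V.\<close>
  define \<gamma> where "\<gamma> = d / C"
  have "\<gamma> > 0"
    using \<open>d > 0\<close> \<open>C > 0\<close> by (simp add: \<gamma>_def)
  have decay: "v \<bullet> (X' \<tau> *v v) + 2 * (v \<bullet> (X \<tau> *v (A *v v))) \<le> - \<gamma> * (v \<bullet> (X \<tau> *v v))"
    if "\<tau> \<in> {0..Tmax}" for \<tau> v
  proof -
    have "\<gamma> * (v \<bullet> (X \<tau> *v v)) \<le> \<gamma> * (C * (norm v)\<^sup>2)"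
      using C [OF that] \<open>\<gamma> > 0\<close> by (intro mult_left_mono) auto
    also have "\<dots> = d * (norm v)\<^sup>2"
      using \<open>C > 0\<close> by (simp add: \<gamma>_def)
    also have "\<dots> \<le> v \<bullet> (Q \<tau> *v v)"
      by (rule d [OF that])
    finally show ?thesis
      by (simp add: Q)
  qed
  \<comment> \<open>The inequality is weakened to a non-strict one so that it also covers v =
    0.\<close>
  have jump': "(AJ *v v) \<bullet> (X 0 *v (AJ *v v)) \<le> v \<bullet> (X \<tau> *v v)" if "\<tau> \<in> {Tmin..Tmax}" for \<tau> v
    using jump_inequality [OF jump [OF that], of v] by (cases "v = 0") auto
  \<comment> \<open>The energy estimate bounds the squared norm by (C / c) exp (- \<gamma> s) times
    the initial squared norm. Taking roots gives this \<open>M\<close> and halves the rate to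
    \<gamma> / 2.\<close>
  define M where "M = sqrt (C / c)"
  have bound: "norm (x s) \<le> M * exp (- (\<gamma> / 2) * s) * norm (x 0)"
    if t: "impulse_instants Tmin Tmax t" and x: "impulsive_solution A AJ t x" and "0 \<le> s" for t x s
  proof -
    obtain k where k: "t k \<le> s" "s < t (Suc k)"
      using impulse_instants_interval [OF t assms(1) \<open>0 \<le> s\<close>] .
    moreover have "t (Suc k) - t k \<le> Tmax"
      using t by (auto simp: impulse_instants_def)
    ultimately have "s - t k \<in> {0..Tmax}"
      by auto
    then have "exp (\<gamma> * s) * (c * (norm (x s))\<^sup>2) \<le> exp (\<gamma> * s) * (x s \<bullet> (X (s - t k) *v x s))"
      by (intro mult_left_mono c) auto
    also have "\<dots> \<le> x 0 \<bullet> (X 0 *v x 0)"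
      using impulsive_solution_decay [OF assms(1) t x X sym decay jump' k] .
    also have "\<dots> \<le> C * (norm (x 0))\<^sup>2"
      using C assms by simp
    finally have "(norm (x s))\<^sup>2 \<le> C / c * exp (- (\<gamma> * s)) * (norm (x 0))\<^sup>2"
      using \<open>c > 0\<close> by (simp add: exp_minus field_simps)
    also have "\<dots> = (M * exp (- (\<gamma> / 2) * s) * norm (x 0))\<^sup>2"
      using \<open>c > 0\<close> \<open>C > 0\<close> by (simp add: M_def power_mult_distrib exp_double [symmetric])
    finally show ?thesis
      using \<open>c > 0\<close> \<open>C > 0\<close> by (rule_tac power2_le_imp_le) (simp_all add: M_def)
  qed
  have "M > 0"
    using \<open>c > 0\<close> \<open>C > 0\<close> by (simp add: M_def)
  then show ?thesis
    unfolding impulsive_stable_def using bound \<open>\<gamma> > 0\<close>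
    by (intro exI [of _ M] conjI exI [of _ "\<gamma> / 2"]) auto
qed

end
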